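(* The following statements hold. (1) Let $h:\mathbb{R}^n\to\mathbb{R}\cup\{+\infty\}$ be a kernel function, let $S\subseteq\operatorname{int}\operatorname{dom}(h)$ be a nonempty convex set, let $\rho>0$, and let $g:\mathbb{R}^n\to\mathbb{R}$ be $\rho$-weakly convex relative to $h$ on $S$. (i) If $\varphi:\mathbb{R}^n\to\mathbb{R}$ is convex on $S$, then $g+\varphi$ is $\rho$-weakly convex relative to $h$ on $S$. (ii) For every $\varrho\in[\rho,\infty)$, $g$ is $\varrho$-weakly convex relative to $h$ on $S$. (iii) For every $\varrho>0$, $\varrho g$ is $\varrho\rho$-weakly convex relative to $h$ on $S$. (2) Let $\mathcal{I}$ be a (nonempty) finite index set, let $h_i:\mathbb{R}^n\to\mathbb{R}\cup\{+\infty\}$, $i\in\mathcal{I}$, be kernel functions, let $S_{\mathcal{I}}\subseteq\bigcap_{i\in\mathcal{I}}\operatorname{int}\operatorname{dom}(h_i)$ be a nonempty convex set, let $\rho_i>0$ for $i\in\mathcal{I}$, and let $g_i:\mathbb{R}^n\to\mathbb{R}$ be $\rho_i$-weakly convex relative to $h_i$ on $S_{\mathcal{I}}$ for each $i\in\mathcal{I}$. (i) $\sum_{i\in\mathcal{I}}g_i$ is $1$-weakly convex relative to $\sum_{i\in\mathcal{I}}\rho_ih_i$ on $S_{\mathcal{I}}$. (ii) If all $h_i$ equal one and the same function $h_{\mathcal{I}}$, then $g_{\mathcal{I}}(x)=\max_{i\in\mathcal{I}}g_i(x)$ is $\rho_{\mathcal{I}}$-weakly convex relative to $h_{\mathcal{I}}$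 on $S_{\mathcal{I}}$, where $\rho_{\mathcal{I}}=\max_{i\in\mathcal{I}}\rho_i$.
   Context: A kernel function is a proper, lower semicontinuous, convex function $h:\mathbb{R}^n\to\mathbb{R}\cup\{+\infty\}$ with $\operatorname{int}\operatorname{dom}(h)\neq\emptyset$ that is continuously differentiable on $\operatorname{int}\operatorname{dom}(h)$. For a convex function $h$, a nonempty convex set $S$ and $\rho>0$, a function $\varphi$ is $\rho$-weakly convex relative to $h$ on $S$ if $\varphi+\rho h$ is convex on $S$. *)

theory Defs
  imports "HOL-Analysis.Analysis"
begin

text \<open>
  Functions with values in the reals extended by plus infinity are modelled as
  \<^typ>\<open>ereal\<close>-valued functions; the value minus infinity is excluded by properness.
\<close>

definition eff_dom :: "('a \<Rightarrow> ereal) \<Rightarrow> 'a set" where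
  "eff_dom h = {x. h x < \<infinity>}"

definition proper_fun :: "('a \<Rightarrow> ereal) \<Rightarrow> bool" where
  "proper_fun h \<longleftrightarrow> (\<forall>x. h x \<noteq> -\<infinity>) \<and> eff_dom h \<noteq> {}"

definition lower_semicont :: "('a::topological_space \<Rightarrow> ereal) \<Rightarrow> bool" where
  "lower_semicont h \<longleftrightarrow> (\<forall>x. h x \<le> Liminf (nhds x) h)"

text \<open>
  The extended-valued counterpart of \<^const>\<open>convex_on\<close>. The weights 0 and 1 are harmless, as
  \<^prop>\<open>0 * (\<infinity>::ereal) = 0\<close>.
\<close>

definition econvex_on :: "'a::real_vector set \<Rightarrow> ('a \<Rightarrow> ereal) \<Rightarrow> bool" where
  "econvex_on S f \<longleftrightarrow> convex S \<and>
    (\<forall>x\<in>S. \<forall>y\<in>S. \<forall>u\<ge>0. \<forall>v\<ge>0. u + v = 1 \<longrightarrow>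
      f (u *\<^sub>R x + v *\<^sub>R y) \<le> ereal u * f x + ereal v * f y)"

lemma econvex_on_ereal_iff: "econvex_on S (\<lambda>x. ereal (f x)) \<longleftrightarrow> convex_on S f"
  by (simp add: econvex_on_def convex_on_def)

text \<open>
  Differentiability is only asked for at interior points of the domain, where a proper \<open>h\<close> is
  finite on a neighbourhood, so that the junk value of \<^const>\<open>real_of_ereal\<close> at infinity
  plays no role.
\<close>

definition cont_diff_on_int_dom :: "('a::real_inner \<Rightarrow> ereal) \<Rightarrow> bool" where
  "cont_diff_on_int_dom h \<longleftrightarrow>
    (\<exists>D. (\<forall>x\<in>interior (eff_dom h). GDERIV (\<lambda>y. real_of_ereal (h y)) x :> D x) \<and>
         continuous_on (interior (eff_dom h)) D)"

definition kernel_function :: "('a::euclidean_space \<Rightarrow> ereal) \<Rightarrow> bool" where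
  "kernel_function h \<longleftrightarrow> proper_fun h \<and> lower_semicont h \<and> econvex_on UNIV h \<and>
    interior (eff_dom h) \<noteq> {} \<and> cont_diff_on_int_dom h"

text \<open>
  The standing requirements on \<open>h\<close>, \<open>S\<close> and \<open>\<rho>\<close> are part of the predicate, so
  that asserting weak convexity includes asserting that the notion is applicable.
\<close>

definition weakly_convex_rel ::
  "real \<Rightarrow> ('a::real_vector \<Rightarrow> ereal) \<Rightarrow> 'a set \<Rightarrow> ('a \<Rightarrow> real) \<Rightarrow> bool" where
  "weakly_convex_rel \<rho> h S \<phi> \<longleftrightarrow>
    econvex_on UNIV h \<and> S \<noteq> {} \<and> convex S \<and> 0 < \<rho> \<and>
    econvex_on S (\<lambda>x. ereal (\<phi> x) + ereal \<rho> * h x)"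

end

theory Submission
  imports Defs
begin

text \<open>A kernel function is finite on the interior of its domain, so on \<open>S\<close> it
  agrees with a real function k, and weak convexity of g says that g + \<rho> k is an ordinary
  convex function on \<open>S\<close> (\<open>weakly_convex_rel_iff_convex_on\<close>). Every claim
  then reduces to closure of convex functions under sums, nonnegative multiples and finite maxima.
  Raising \<rho> to r adds (r - \<rho>) k, which is convex because h is. For sums, add the functions
  g_i + \<rho>_i k_i. For maxima, first raise all constants to their maximum r; then max (g_i + r k)
  = (max g_i) + r k.

  The predicate also demands that the reference function be convex on the whole space, where it may
  be infinite. For the new reference function \<Sum> \<rho>_i h_i this is shown in extended
  arithmetic by \<open>econvex_on_cmult\<close> and \<open>econvex_on_sum\<close>.\<close>

lemma econvex_on_cmult:
  assumes "econvex_on S f" "0 \<le> c" "\<And>x. x \<in> S \<Longrightarrow> f x \<noteq> -\<infinity>"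
  shows "econvex_on S (\<lambda>x. ereal c * f x)"
  unfolding econvex_on_def
proof (intro conjI ballI allI impI)
  show "convex S"
    using assms(1) by (simp add: econvex_on_def)
  fix x y and u v :: real
  assume *: "x \<in> S" "y \<in> S" "0 \<le> u" "0 \<le> v" "u + v = 1"
  have "f (u *\<^sub>R x + v *\<^sub>R y) \<le> ereal u * f x + ereal v * f y"
    using assms(1) * by (simp add: econvex_on_def)
  then have "ereal c * f (u *\<^sub>R x + v *\<^sub>R y) \<le> ereal c * (ereal u * f x + ereal v * f y)"
    using assms(2) by (simp add: ereal_mult_left_mono)
  also have "\<dots> = ereal u * (ereal c * f x) + ereal v * (ereal c * f y)"
    \<comment> \<open>With -\<infinity> excluded, distributivity is checked on real and +\<infinity>
      values; a zero factor causes no trouble because 0 * \<infinity> = 0.\<close>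
    using assms(2) assms(3)[of x] assms(3)[of y] *
    by (cases "f x"; cases "f y") (auto simp: algebra_simps)
  finally show "ereal c * f (u *\<^sub>R x + v *\<^sub>R y)
      \<le> ereal u * (ereal c * f x) + ereal v * (ereal c * f y)" .
qed

lemma econvex_on_add:
  assumes "econvex_on S f" "econvex_on S g"
    and "\<And>x. x \<in> S \<Longrightarrow> f x \<noteq> -\<infinity>" "\<And>x. x \<in> S \<Longrightarrow> g x \<noteq> -\<infinity>"
  shows "econvex_on S (\<lambda>x. f x + g x)"
  unfolding econvex_on_def
proof (intro conjI ballI allI impI)
  show "convex S"
    using assms(1) by (simp add: econvex_on_def)
  fix x y and u v :: real
  assume *: "x \<in> S" "y \<in> S" "0 \<le> u" "0 \<le> v" "u + v = 1"
  have "f (u *\<^sub>R x + v *\<^sub>R y) + g (u *\<^sub>R x + v *\<^sub>R y)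
      \<le> (ereal u * f x + ereal v * f y) + (ereal u * g x + ereal v * g y)"
    using assms(1,2) * by (intro add_mono) (simp_all add: econvex_on_def)
  also have "\<dots> = ereal u * (f x + g x) + ereal v * (f y + g y)"
    using assms(3)[of x] assms(3)[of y] assms(4)[of x] assms(4)[of y] *
    by (cases "f x"; cases "f y"; cases "g x"; cases "g y") (auto simp: algebra_simps)
  finally show "f (u *\<^sub>R x + v *\<^sub>R y) + g (u *\<^sub>R x + v *\<^sub>R y)
      \<le> ereal u * (f x + g x) + ereal v * (f y + g y)" .
qed

text \<open>Keeps the partial sums away from -\<infinity>, as \<open>econvex_on_add\<close> requires
  in the induction for \<open>econvex_on_sum\<close>.\<close>

lemma sum_ereal_neq_MInf:
  fixes f :: "'i \<Rightarrow> ereal"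
  assumes "\<And>i. i \<in> I \<Longrightarrow> f i \<noteq> -\<infinity>"
  shows "(\<Sum>i\<in>I. f i) \<noteq> -\<infinity>"
  using assms by (induction I rule: infinite_finite_induct) auto

lemma econvex_on_sum:
  assumes "convex S" "\<And>i. i \<in> I \<Longrightarrow> econvex_on S (f i)"
    and "\<And>i x. i \<in> I \<Longrightarrow> x \<in> S \<Longrightarrow> f i x \<noteq> -\<infinity>"
  shows "econvex_on S (\<lambda>x. \<Sum>i\<in>I. f i x)"
  using assms
proof (induction I rule: infinite_finite_induct)
  case (insert i I)
  then show ?case
    by (auto intro!: econvex_on_add sum_ereal_neq_MInf)
\<comment> \<open>For empty or infinite \<open>I\<close> the sum is 0 by convention, and only
  convexity of \<open>S\<close> remains.\<close>
qed (simp_all add: econvex_on_def)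

lemma convex_on_Max:
  assumes "finite I" "I \<noteq> {}" "\<And>i. i \<in> I \<Longrightarrow> convex_on S (f i)"
  shows "convex_on S (\<lambda>x. Max ((\<lambda>i. f i x) ` I))"
proof (rule convex_onI)
  show "convex S"
    using assms(2,3) by (auto simp: convex_on_def)
next
  fix t x y
  assume *: "0 < t" "t < (1::real)" "x \<in> S" "y \<in> S"
  let ?M = "\<lambda>x. Max ((\<lambda>i. f i x) ` I)"
  \<comment> \<open>A bound on each \<open>f i\<close> by the same right-hand side, independent of
    \<open>i\<close>, bounds their maximum.\<close>
  have "f i ((1 - t) *\<^sub>R x + t *\<^sub>R y) \<le> (1 - t) * ?M x + t * ?M y" if "i \<in> I" for i
  proof -
    have "f i ((1 - t) *\<^sub>R x + t *\<^sub>R y) \<le> (1 - t) * f i x + t * f i y"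
      using assms(3)[OF that] * by (intro convex_onD) auto
    also have "\<dots> \<le> (1 - t) * ?M x + t * ?M y"
      using that assms(1) * by (intro add_mono mult_left_mono) auto
    finally show ?thesis .
  qed
  then show "?M ((1 - t) *\<^sub>R x + t *\<^sub>R y) \<le> (1 - t) * ?M x + t * ?M y"
    using assms(1,2) by simp
qed

text \<open>Convexity of \<open>S\<close>, which is part of the predicate, keeps convex combinations
  inside \<open>S\<close>, so only values on \<open>S\<close> enter.\<close>

lemma econvex_on_cong:
  assumes "\<And>x. x \<in> S \<Longrightarrow> f x = g x"
  shows "econvex_on S f \<longleftrightarrow> econvex_on S g"
  unfolding econvex_on_def using assms by (auto simp: convex_def)

text \<open>The bridge from extended to real arithmetic: once \<open>h\<close> is finite on
  \<open>S\<close>, library facts on \<open>convex_on\<close> apply.\<close>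

lemma weakly_convex_rel_iff_convex_on:
  assumes "\<And>x. x \<in> S \<Longrightarrow> h x = ereal (k x)"
  shows "weakly_convex_rel \<rho> h S g \<longleftrightarrow>
    econvex_on UNIV h \<and> S \<noteq> {} \<and> 0 < \<rho> \<and> convex_on S (\<lambda>x. g x + \<rho> * k x)"
proof -
  have "econvex_on S (\<lambda>x. ereal (g x) + ereal \<rho> * h x) \<longleftrightarrow>
      econvex_on S (\<lambda>x. ereal (g x + \<rho> * k x))"
    by (rule econvex_on_cong) (simp add: assms)
  then show ?thesis
    by (auto simp: weakly_convex_rel_def econvex_on_ereal_iff convex_on_def)
qed

lemma econvex_on_imp_convex_on:
  assumes "econvex_on T h" "S \<subseteq> T" "convex S" "\<And>x. x \<in> S \<Longrightarrow> h x = ereal (k x)"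
  shows "convex_on S k"
proof -
  have "econvex_on S h"
    using assms(1-3) by (auto simp: econvex_on_def subset_iff)
  then have "econvex_on S (\<lambda>x. ereal (k x))"
    using econvex_on_cong[of S h "\<lambda>x. ereal (k x)"] assms(4) by blast
  then show ?thesis
    by (simp add: econvex_on_ereal_iff)
qed

text \<open>Membership in the domain rules out +\<infinity> and properness rules out -\<infinity>.
  This supplies the real representative \<open>k\<close> that the closure lemmas below take as
  given.\<close>

lemma kernel_function_finite:
  assumes "kernel_function h" "x \<in> interior (eff_dom h)"
  shows "h x = ereal (real_of_ereal (h x))"
proof -
  have "x \<in> eff_dom h"
    using assms(2) interior_subset by blast
  then have "h x \<noteq> \<infinity>" "h x \<noteq> -\<infinity>"
    using assms(1) by (auto simp: eff_dom_def kernel_function_def proper_fun_def)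
  then show ?thesis
    by (cases "h x") auto
qed

lemma weakly_convex_rel_add:
  assumes "weakly_convex_rel \<rho> h S g" "convex_on S \<phi>"
    and h: "\<And>x. x \<in> S \<Longrightarrow> h x = ereal (k x)"
  shows "weakly_convex_rel \<rho> h S (\<lambda>x. g x + \<phi> x)"
  using assms(1) convex_on_add[OF _ assms(2), of "\<lambda>x. g x + \<rho> * k x"]
  by (simp add: weakly_convex_rel_iff_convex_on[OF h] algebra_simps)

lemma weakly_convex_rel_mono:
  assumes "weakly_convex_rel \<rho> h S g" "\<rho> \<le> r"
    and h: "\<And>x. x \<in> S \<Longrightarrow> h x = ereal (k x)"
  shows "weakly_convex_rel r h S g"
proof -
  have g: "convex_on S (\<lambda>x. g x + \<rho> * k x)"
    using assms(1) by (simp add: weakly_convex_rel_iff_convex_on[OF h])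
  have "convex_on S k"
    using assms(1) by (intro econvex_on_imp_convex_on[OF _ _ _ h, of UNIV])
      (auto simp: weakly_convex_rel_def)
  \<comment> \<open>Split r k as \<rho> k + (r - \<rho>) k; the excess is a nonnegative multiple of
    the convex \<open>k\<close>.\<close>
  then have "convex_on S (\<lambda>x. (g x + \<rho> * k x) + (r - \<rho>) * k x)"
    using assms(2) by (intro convex_on_add[OF g] convex_on_cmul) auto
  then show ?thesis
    using assms(1,2) by (simp add: weakly_convex_rel_iff_convex_on[OF h] algebra_simps)
qed

lemma weakly_convex_rel_cmult:
  assumes "weakly_convex_rel \<rho> h S g" "0 < r"
    and h: "\<And>x. x \<in> S \<Longrightarrow> h x = ereal (k x)"
  shows "weakly_convex_rel (r * \<rho>) h S (\<lambda>x. r * g x)"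
  using assms(1,2) convex_on_cmul[of r S "\<lambda>x. g x + \<rho> * k x"]
  by (simp add: weakly_convex_rel_iff_convex_on[OF h] algebra_simps)

lemma weakly_convex_rel_sum:
  assumes "I \<noteq> {}"
    and "\<And>i. i \<in> I \<Longrightarrow> weakly_convex_rel (\<rho> i) (h i) S (g i)"
    and proper: "\<And>i x. i \<in> I \<Longrightarrow> h i x \<noteq> -\<infinity>"
    and h: "\<And>i x. i \<in> I \<Longrightarrow> x \<in> S \<Longrightarrow> h i x = ereal (k i x)"
  shows "weakly_convex_rel 1 (\<lambda>x. \<Sum>i\<in>I. ereal (\<rho> i) * h i x) S (\<lambda>x. \<Sum>i\<in>I. g i x)"
proof -
  have pos: "0 < \<rho> i" and conv: "econvex_on UNIV (h i)"
    and g: "convex_on S (\<lambda>x. g i x + \<rho> i * k i x)" if "i \<in> I" for i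
    using assms(2)[OF that] by (auto simp: weakly_convex_rel_iff_convex_on[OF h[OF that]])
  have S: "convex S" "S \<noteq> {}"
    using assms(1,2) by (auto simp: weakly_convex_rel_def)
  have neq: "ereal (\<rho> i) * h i x \<noteq> -\<infinity>" if "i \<in> I" for i x
    using pos[OF that] proper[OF that, of x] by (cases "h i x") auto
  \<comment> \<open>Off \<open>S\<close> the summands may be +\<infinity>, so this part cannot pass
    through the real representatives \<open>k i\<close>.\<close>
  have "econvex_on UNIV (\<lambda>x. \<Sum>i\<in>I. ereal (\<rho> i) * h i x)"
    using pos conv proper neq
    by (intro econvex_on_sum econvex_on_cmult) (auto intro: less_imp_le)
  \<comment> \<open>The factor 1 is the weak convexity constant, written out to match the bridge
    lemma; the weights \<rho>_i have moved into the reference function.\<close>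
  moreover have "convex_on S (\<lambda>x. (\<Sum>i\<in>I. g i x) + 1 * (\<Sum>i\<in>I. \<rho> i * k i x))"
  proof -
    have "econvex_on S (\<lambda>x. \<Sum>i\<in>I. ereal (g i x + \<rho> i * k i x))"
      using g S by (intro econvex_on_sum) (auto simp: econvex_on_ereal_iff)
    then show ?thesis
      by (simp add: econvex_on_ereal_iff sum.distrib)
  qed
  moreover have "(\<Sum>i\<in>I. ereal (\<rho> i) * h i x) = ereal (\<Sum>i\<in>I. \<rho> i * k i x)" if "x \<in> S" for x
    using h that by simp
  ultimately show ?thesis
    using S by (subst weakly_convex_rel_iff_convex_on) auto
qed

lemma weakly_convex_rel_Max:
  assumes I: "finite I" "I \<noteq> {}"
    and "\<And>i. i \<in> I \<Longrightarrow> weakly_convex_rel (\<rho> i) h S (g i)"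
    and h: "\<And>x. x \<in> S \<Longrightarrow> h x = ereal (k x)"
  shows "weakly_convex_rel (Max (\<rho> ` I)) h S (\<lambda>x. Max ((\<lambda>i. g i x) ` I))"
proof -
  let ?r = "Max (\<rho> ` I)"
  \<comment> \<open>A common constant makes the term added to each \<open>g i\<close> independent of
    \<open>i\<close>, so that it can be pulled out of the maximum below.\<close>
  have r: "weakly_convex_rel ?r h S (g i)" if "i \<in> I" for i
    using that I by (intro weakly_convex_rel_mono[OF assms(3) _ h]) auto
  have "convex_on S (\<lambda>x. Max ((\<lambda>i. g i x + ?r * k x) ` I))"
    using r by (intro convex_on_Max I) (simp add: weakly_convex_rel_iff_convex_on[OF h])
  moreover have "Max ((\<lambda>i. g i x + ?r * k x) ` I) = Max ((\<lambda>i. g i x) ` I) + ?r * k x" for x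
    using I by (rule Max_add_commute)
  ultimately have "convex_on S (\<lambda>x. Max ((\<lambda>i. g i x) ` I) + ?r * k x)"
    by simp
  moreover obtain i where "i \<in> I"
    using I by blast
  ultimately show ?thesis
    using r[of i] by (simp add: weakly_convex_rel_iff_convex_on[OF h])
qed

theorem proposition3p6:
  shows
  "(\<forall>(h :: real ^ 'n \<Rightarrow> ereal) (S :: (real ^ 'n) set) (\<rho> :: real) (g :: real ^ 'n \<Rightarrow> real).
      kernel_function h \<and> S \<subseteq> interior (eff_dom h) \<and> S \<noteq> {} \<and> convex S \<and> 0 < \<rho> \<and>
      weakly_convex_rel \<rho> h S g \<longrightarrow>
        (\<forall>\<phi> :: real ^ 'n \<Rightarrow> real. convex_on S \<phi> \<longrightarrow> weakly_convex_rel \<rho> h S (\<lambda>x. g x + \<phi> x)) \<and>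
        (\<forall>r :: real. \<rho> \<le> r \<longrightarrow> weakly_convex_rel r h S g) \<and>
        (\<forall>r :: real. 0 < r \<longrightarrow> weakly_convex_rel (r * \<rho>) h S (\<lambda>x. r * g x)))
   \<and>
   (\<forall>(I :: 'i set) (h :: 'i \<Rightarrow> real ^ 'n \<Rightarrow> ereal) (S :: (real ^ 'n) set)
      (\<rho> :: 'i \<Rightarrow> real) (g :: 'i \<Rightarrow> real ^ 'n \<Rightarrow> real).
      finite I \<and> I \<noteq> {} \<and> (\<forall>i\<in>I. kernel_function (h i)) \<and>
      S \<subseteq> (\<Inter>i\<in>I. interior (eff_dom (h i))) \<and> S \<noteq> {} \<and> convex S \<and>
      (\<forall>i\<in>I. 0 < \<rho> i) \<and> (\<forall>i\<in>I. weakly_convex_rel (\<rho> i) (h i) S (g i)) \<longrightarrow>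
        weakly_convex_rel 1 (\<lambda>x. \<Sum>i\<in>I. ereal (\<rho> i) * h i x) S (\<lambda>x. \<Sum>i\<in>I. g i x) \<and>
        (\<forall>hI :: real ^ 'n \<Rightarrow> ereal. (\<forall>i\<in>I. h i = hI) \<longrightarrow>
          weakly_convex_rel (Max (\<rho> ` I)) hI S (\<lambda>x. Max ((\<lambda>i. g i x) ` I))))"
proof (intro conjI allI impI; elim conjE)
  fix h :: "real ^ 'n \<Rightarrow> ereal" and S \<rho> and g :: "real ^ 'n \<Rightarrow> real"
  assume "kernel_function h" "S \<subseteq> interior (eff_dom h)"
  then have h: "h x = ereal (real_of_ereal (h x))" if "x \<in> S" for x
    using that by (intro kernel_function_finite) auto
  assume g: "weakly_convex_rel \<rho> h S g"
  show "weakly_convex_rel \<rho> h S (\<lambda>x. g x + \<phi> x)" if "convex_on S \<phi>" for \<phi>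
    using g that h by (rule weakly_convex_rel_add)
  show "weakly_convex_rel r h S g" if "\<rho> \<le> r" for r
    using g that h by (rule weakly_convex_rel_mono)
  show "weakly_convex_rel (r * \<rho>) h S (\<lambda>x. r * g x)" if "0 < r" for r
    using g that h by (rule weakly_convex_rel_cmult)
next
  fix I :: "'i set" and h :: "'i \<Rightarrow> real ^ 'n \<Rightarrow> ereal" and S \<rho>
    and g :: "'i \<Rightarrow> real ^ 'n \<Rightarrow> real"
  assume I: "finite I" "I \<noteq> {}" and kernel: "\<forall>i\<in>I. kernel_function (h i)"
    and S: "S \<subseteq> (\<Inter>i\<in>I. interior (eff_dom (h i)))"
    and g: "\<forall>i\<in>I. weakly_convex_rel (\<rho> i) (h i) S (g i)"
  have h: "h i x = ereal (real_of_ereal (h i x))" if "i \<in> I" "x \<in> S" for i x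
    using that kernel S by (intro kernel_function_finite) auto
  show "weakly_convex_rel 1 (\<lambda>x. \<Sum>i\<in>I. ereal (\<rho> i) * h i x) S (\<lambda>x. \<Sum>i\<in>I. g i x)"
    using I(2) g kernel
    by (intro weakly_convex_rel_sum[OF _ _ _ h]) (auto simp: kernel_function_def proper_fun_def)
  show "weakly_convex_rel (Max (\<rho> ` I)) hI S (\<lambda>x. Max ((\<lambda>i. g i x) ` I))"
    if hI: "\<forall>i\<in>I. h i = hI" for hI
  proof (rule weakly_convex_rel_Max[OF I])
    show "weakly_convex_rel (\<rho> i) hI S (g i)" if "i \<in> I" for i
      using g hI that by auto
    show "hI x = ereal (real_of_ereal (hI x))" if "x \<in> S" for x
      \<comment> \<open>Nonemptiness of \<open>I\<close> provides an index \<open>i\<close> with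
        \<open>h i = hI\<close>, whose finiteness on \<open>S\<close> is known.\<close>
      using h[OF _ that] hI I(2) by force
  qed
qed

end
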